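(* On the set of the $512$ mesh patterns $(21,R)$, $R\subseteq\{0,1,2\}\times\{0,1,2\}$, the equivalence relation of coincidence under $321$ (that is, $p_1\sim p_2$ if and only if $\mathrm{Av}(\{321,p_1\})=\mathrm{Av}(\{321,p_2\})$) has exactly $29$ equivalence classes.
   Context: Write $[n]=\{1,\dots,n\}$. A permutation of length $n$ is a bijection of $[n]$, written in one-line notation; $G(\pi)=\{(i,\pi(i)) : i\in[n]\}$ is its plot. A mesh pattern of length $k$ is a pair $p=(\tau,R)$ with $\tau$ a permutation of length $k$ and $R\subseteq\{0,\dots,k\}^2$. An occurrence of $p$ in a permutation $\pi$ of length $n$ is a subset $\omega\subseteq G(\pi)$ for which there are order-preserving injections $\alpha,\beta:[k]\to[n]$ such that (i) $\omega=\{(\alpha(i),\beta(j)):(i,j)\in G(\tau)\}$, and (ii) with $\alpha(0)=\beta(0)=0$, $\alpha(k+1)=\beta(k+1)=n+1$ and $R_{ij}=[\alpha(i)+1,\alpha(i+1)-1]\times[\beta(j)+1,\beta(j+1)-1]$, one has $R_{ij}\cap G(\pi)=\emptyset$ for every $(i,j)\in R$. A permutation avoids $p$ if it has no occurrence of $p$. A classical pattern $\pi$ is identified with the mesh pattern $(\pi,\emptyset)$. $\mathrm{Av}(S)$ is the set of all permutations (of all lengths, including the empty one) avoiding every pattern in $S$. *)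

theory Defs
  imports "HOL-Combinatorics.Combinatorics"
begin

text \<open>
  A permutation is represented by its one-line notation, a list over \<open>nat\<close>. Its entries are
  1-based, whereas list indexing is 0-based, hence the shift in \<open>plot\<close>.
\<close>

definition perms :: "nat list set" where
  "perms = (\<Union>n. permutations_of_set {1..n})"

definition plot :: "nat list \<Rightarrow> (nat \<times> nat) set" where
  "plot \<pi> = {(i, \<pi> ! (i - 1)) | i. i \<in> {1..length \<pi>}}"

type_synonym mesh_pattern = "nat list \<times> (nat \<times> nat) set"

definition mesh_patterns_on :: "nat list \<Rightarrow> mesh_pattern set" where
  "mesh_patterns_on \<tau> = {(\<tau>, R) | R. R \<subseteq> {0..length \<tau>} \<times> {0..length \<tau>}}"

text \<open>
  The injections from \<open>[k]\<close> to \<open>[n]\<close> are total functions on \<open>nat\<close> that carry the boundary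
  values at \<open>0\<close> and \<open>k + 1\<close>; their values beyond \<open>k + 1\<close> play no role.
\<close>

definition embedding :: "nat \<Rightarrow> nat \<Rightarrow> (nat \<Rightarrow> nat) \<Rightarrow> bool" where
  "embedding k n \<alpha> \<longleftrightarrow>
     \<alpha> ` {1..k} \<subseteq> {1..n} \<and> strict_mono_on {1..k} \<alpha> \<and> \<alpha> 0 = 0 \<and> \<alpha> (k + 1) = n + 1"

definition region :: "(nat \<Rightarrow> nat) \<Rightarrow> (nat \<Rightarrow> nat) \<Rightarrow> nat \<Rightarrow> nat \<Rightarrow> (nat \<times> nat) set" where
  "region \<alpha> \<beta> i j = {\<alpha> i + 1..\<alpha> (i + 1) - 1} \<times> {\<beta> j + 1..\<beta> (j + 1) - 1}"

definition occurrence :: "mesh_pattern \<Rightarrow> nat list \<Rightarrow> (nat \<times> nat) set \<Rightarrow> bool" where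
  "occurrence p \<pi> \<omega> \<longleftrightarrow> (case p of (\<tau>, R) \<Rightarrow>
     \<omega> \<subseteq> plot \<pi> \<and>
     (\<exists>\<alpha> \<beta>. embedding (length \<tau>) (length \<pi>) \<alpha> \<and> embedding (length \<tau>) (length \<pi>) \<beta> \<and>
        \<omega> = {(\<alpha> i, \<beta> j) | i j. (i, j) \<in> plot \<tau>} \<and>
        (\<forall>(i, j) \<in> R. region \<alpha> \<beta> i j \<inter> plot \<pi> = {})))"

definition avoids :: "nat list \<Rightarrow> mesh_pattern \<Rightarrow> bool" where
  "avoids \<pi> p \<longleftrightarrow> \<not> (\<exists>\<omega>. occurrence p \<pi> \<omega>)"

definition Av :: "mesh_pattern set \<Rightarrow> nat list set" where
  "Av S = {\<pi> \<in> perms. \<forall>p \<in> S. avoids \<pi> p}"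

definition classical :: "nat list \<Rightarrow> mesh_pattern" where
  "classical \<pi> = (\<pi>, {})"

definition coincidence_under :: "nat list \<Rightarrow> mesh_pattern set \<Rightarrow> mesh_pattern rel" where
  "coincidence_under \<pi> M =
     {(p, q) \<in> M \<times> M. Av {classical \<pi>, p} = Av {classical \<pi>, q}}"

end

theory Submission
  imports Defs
begin

text \<open>
  Under avoidance of 321, the boxes (0,2), (1,1) and (2,0) of an occurrence of 21 are always empty,
  so only six boxes matter. A point in the box (0,1) or (1,2) can replace the upper left point of
  the occurrence, moving it down left or up right, and a point in (1,0) or (2,1) can replace the
  lower right point in the same way. Choosing an occurrence that is extremal for a suitable linear
  function of its coordinates therefore empties further boxes for free, as long as the moves keep
  the boxes that are already shaded empty. Together with the one exchange
  {00, 01, 10, 22} ~ {00, 12, 21, 22} and the symmetries of the square that fix 21 (transposition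
  and rotation by 180 degrees), this leaves 29 shadings, which six permutations of length at most 4
  tell apart.
\<close>

section \<open>Occurrences of 21 in point sets\<close>

text \<open>Distinct first and distinct second coordinates are what is kept of the plot of a
  permutation. The coordinates need not fill an interval starting at 1, so these sets are closed
  under negation.\<close>

definition avoiding_321 :: "(int \<times> int) set \<Rightarrow> bool" where
  "avoiding_321 P \<longleftrightarrow> finite P \<and> inj_on fst P \<and> inj_on snd P \<and>
     \<not> (\<exists>x1 y1 x2 y2 x3 y3. (x1, y1) \<in> P \<and> (x2, y2) \<in> P \<and> (x3, y3) \<in> P \<and>
          x1 < x2 \<and> x2 < x3 \<and> y3 < y2 \<and> y2 < y1)"

text \<open>
  The flag \<open>bij\<close> tells whether the box in column \<open>i\<close> and row \<open>j\<close> is shaded. Points have integer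
  coordinates so that rotation by 180 degrees is negation.
\<close>

definition unshaded ::
  "bool \<Rightarrow> bool \<Rightarrow> bool \<Rightarrow> bool \<Rightarrow> bool \<Rightarrow> bool \<Rightarrow> int \<Rightarrow> int \<Rightarrow> int \<Rightarrow> int \<Rightarrow> int \<Rightarrow> int \<Rightarrow> bool"
  where
  "unshaded b00 b01 b10 b12 b21 b22 x1 y1 x2 y2 x y \<longleftrightarrow>
     (b00 \<longrightarrow> \<not> (x < x1 \<and> y < y2)) \<and>
     (b01 \<longrightarrow> \<not> (x < x1 \<and> y2 < y \<and> y < y1)) \<and>
     (b10 \<longrightarrow> \<not> (x1 < x \<and> x < x2 \<and> y < y2)) \<and>
     (b12 \<longrightarrow> \<not> (x1 < x \<and> x < x2 \<and> y1 < y)) \<and>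
     (b21 \<longrightarrow> \<not> (x2 < x \<and> y2 < y \<and> y < y1)) \<and>
     (b22 \<longrightarrow> \<not> (x2 < x \<and> y1 < y))"

definition occ21 ::
  "(int \<times> int) set \<Rightarrow> bool \<Rightarrow> bool \<Rightarrow> bool \<Rightarrow> bool \<Rightarrow> bool \<Rightarrow> bool \<Rightarrow> int \<Rightarrow> int \<Rightarrow> int \<Rightarrow> int \<Rightarrow> bool"
  where
  "occ21 P b00 b01 b10 b12 b21 b22 x1 y1 x2 y2 \<longleftrightarrow>
     (x1, y1) \<in> P \<and> (x2, y2) \<in> P \<and> x1 < x2 \<and> y2 < y1 \<and>
     (\<forall>x y. (x, y) \<in> P \<longrightarrow> unshaded b00 b01 b10 b12 b21 b22 x1 y1 x2 y2 x y)"

definition contains21 ::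
  "(int \<times> int) set \<Rightarrow> bool \<Rightarrow> bool \<Rightarrow> bool \<Rightarrow> bool \<Rightarrow> bool \<Rightarrow> bool \<Rightarrow> bool" where
  "contains21 P b00 b01 b10 b12 b21 b22 \<longleftrightarrow>
     (\<exists>x1 y1 x2 y2. occ21 P b00 b01 b10 b12 b21 b22 x1 y1 x2 y2)"

lemma avoiding_321_inj:
  "avoiding_321 P \<Longrightarrow> (x, y) \<in> P \<Longrightarrow> (x', y') \<in> P \<Longrightarrow> x = x' \<longleftrightarrow> y = y'"
  using inj_onD[of fst P "(x, y)" "(x', y')"] inj_onD[of snd P "(x, y)" "(x', y')"]
  by (auto simp: avoiding_321_def)

lemma contains21I:
  "occ21 P b00 b01 b10 b12 b21 b22 x1 y1 x2 y2 \<Longrightarrow> contains21 P b00 b01 b10 b12 b21 b22"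
  by (auto simp: contains21_def)

lemma contains21_mono:
  assumes "contains21 P b00 b01 b10 b12 b21 b22"
    and "c00 \<longrightarrow> b00" "c01 \<longrightarrow> b01" "c10 \<longrightarrow> b10" "c12 \<longrightarrow> b12" "c21 \<longrightarrow> b21" "c22 \<longrightarrow> b22"
  shows "contains21 P c00 c01 c10 c12 c21 c22"
proof -
  obtain x1 y1 x2 y2 where "occ21 P b00 b01 b10 b12 b21 b22 x1 y1 x2 y2"
    using assms(1) by (auto simp: contains21_def)
  then have "occ21 P c00 c01 c10 c12 c21 c22 x1 y1 x2 y2"
    using assms(2-) unfolding occ21_def unshaded_def by blast
  then show ?thesis by (rule contains21I)
qed

text \<open>The maximum exists because \<open>P\<close> is finite. Each application picks
  \<open>m\<close> so that replacing a point of the occurrence by one in an unwanted box would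
  strictly increase it.\<close>

lemma maximal_occ21:
  fixes m :: "int \<Rightarrow> int \<Rightarrow> int \<Rightarrow> int \<Rightarrow> int"
  assumes "avoiding_321 P" and "contains21 P b00 b01 b10 b12 b21 b22"
  obtains x1 y1 x2 y2 where "occ21 P b00 b01 b10 b12 b21 b22 x1 y1 x2 y2"
    and "\<And>u1 v1 u2 v2. occ21 P b00 b01 b10 b12 b21 b22 u1 v1 u2 v2 \<Longrightarrow> m u1 v1 u2 v2 \<le> m x1 y1 x2 y2"
proof -
  let ?A = "{((x1, y1), (x2, y2)) | x1 y1 x2 y2. occ21 P b00 b01 b10 b12 b21 b22 x1 y1 x2 y2}"
  let ?m = "\<lambda>((x1, y1), (x2, y2)). m x1 y1 x2 y2"
  have "?A \<subseteq> P \<times> P" by (auto simp: occ21_def)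
  moreover have "finite P" using assms(1) by (simp add: avoiding_321_def)
  ultimately have fin: "finite ?A" by (meson finite_SigmaI finite_subset)
  have "?A \<noteq> {}" using assms(2) by (auto simp: contains21_def)
  then have "Max (?m ` ?A) \<in> ?m ` ?A" using fin by (intro Max_in) auto
  then obtain x1 y1 x2 y2 where *: "occ21 P b00 b01 b10 b12 b21 b22 x1 y1 x2 y2"
    "Max (?m ` ?A) = m x1 y1 x2 y2" by auto
  show ?thesis
  proof (rule that[OF *(1)])
    fix u1 v1 u2 v2 assume "occ21 P b00 b01 b10 b12 b21 b22 u1 v1 u2 v2"
    then have "?m ((u1, v1), (u2, v2)) \<in> ?m ` ?A" by (intro imageI) auto
    then have "?m ((u1, v1), (u2, v2)) \<le> Max (?m ` ?A)" using fin by (intro Max_ge) auto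
    then show "m u1 v1 u2 v2 \<le> m x1 y1 x2 y2" using * by simp
  qed
qed

section \<open>Symmetries of the square that fix 21\<close>

text \<open>Transposition sends box (i,j) to (j,i). It also exchanges the two points: the upper left
  one becomes the lower right one.\<close>

lemma contains21_swap:
  "contains21 (prod.swap ` P) b00 b01 b10 b12 b21 b22 \<longleftrightarrow> contains21 P b00 b10 b01 b21 b12 b22"
proof -
  have "occ21 (prod.swap ` P) b00 b01 b10 b12 b21 b22 x1 y1 x2 y2 \<longleftrightarrow>
      occ21 P b00 b10 b01 b21 b12 b22 y2 x2 y1 x1" for x1 y1 x2 y2
  proof -
    have "(x, y) \<in> prod.swap ` P \<longleftrightarrow> (y, x) \<in> P" for x y by force
    then show ?thesis unfolding occ21_def unshaded_def by (simp only:) blast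
  qed
  then show ?thesis unfolding contains21_def by blast
qed

lemma avoiding_321_swap:
  assumes "avoiding_321 P"
  shows "avoiding_321 (prod.swap ` P)"
proof -
  have mem: "(x, y) \<in> prod.swap ` P \<longleftrightarrow> (y, x) \<in> P" for x y by force
  have "inj_on fst (prod.swap ` P)" "inj_on snd (prod.swap ` P)"
    using avoiding_321_inj[OF assms] by (auto simp: inj_on_def)
  then show ?thesis using assms unfolding avoiding_321_def mem by blast
qed

text \<open>Rotation sends box (i,j) to (2-i,2-j), so the six flags are read backwards.\<close>

lemma contains21_uminus:
  "contains21 (map_prod uminus uminus ` P) b00 b01 b10 b12 b21 b22 \<longleftrightarrow> contains21 P b22 b21 b12 b10 b01 b00"
proof -
  have mem: "(x, y) \<in> map_prod uminus uminus ` P \<longleftrightarrow> (- x, - y) \<in> P" for x y by force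
  have neg: "(\<forall>x y. (- x, - y) \<in> P \<longrightarrow> Q x y) \<longleftrightarrow> (\<forall>x y. (x, y) \<in> P \<longrightarrow> Q (- x) (- y))" for Q
    by (metis minus_minus)
  have "occ21 (map_prod uminus uminus ` P) b00 b01 b10 b12 b21 b22 x1 y1 x2 y2 \<longleftrightarrow>
      occ21 P b22 b21 b12 b10 b01 b00 (- x2) (- y2) (- x1) (- y1)" for x1 y1 x2 y2
    unfolding occ21_def unshaded_def mem neg by (auto simp: minus_less_iff less_minus_iff)
  then show ?thesis unfolding contains21_def by (metis minus_minus)
qed

lemma avoiding_321_uminus:
  assumes "avoiding_321 P"
  shows "avoiding_321 (map_prod uminus uminus ` P)"
proof -
  have mem: "(x, y) \<in> map_prod uminus uminus ` P \<longleftrightarrow> (- x, - y) \<in> P" for x y by force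
  have "inj_on fst (map_prod uminus uminus ` P)" "inj_on snd (map_prod uminus uminus ` P)"
    using avoiding_321_inj[OF assms] by (auto simp: inj_on_def)
  moreover have "finite (map_prod uminus uminus ` P)" using assms by (simp add: avoiding_321_def)
  moreover have False if "(x1, y1) \<in> map_prod uminus uminus ` P" "(x2, y2) \<in> map_prod uminus uminus ` P"
    "(x3, y3) \<in> map_prod uminus uminus ` P" "x1 < x2" "x2 < x3" "y3 < y2" "y2 < y1" for x1 y1 x2 y2 x3 y3
  proof -
    have "- x3 < - x2" "- x2 < - x1" "- y1 < - y2" "- y2 < - y3" using that by auto
    then show False using assms that(1-3) unfolding avoiding_321_def mem by blast
  qed
  ultimately show ?thesis unfolding avoiding_321_def by blast
qed

section \<open>Shading further boxes\<close>

text \<open>Minimise \<open>x1 + x2\<close>. A point in (0,1) would be a better upper left point and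
  one in (1,0) a better lower right point; both moves go down left and do not enlarge (0,0).\<close>

lemma contains21_add_01_10:
  assumes "avoiding_321 P" "contains21 P b00 False False False False False"
  shows "contains21 P b00 True True False False False"
proof -
  obtain x1 y1 x2 y2 where o: "occ21 P b00 False False False False False x1 y1 x2 y2"
    and m: "\<And>u1 v1 u2 v2. occ21 P b00 False False False False False u1 v1 u2 v2 \<Longrightarrow>
      - (u1 + u2) \<le> - (x1 + x2)"
    by (rule maximal_occ21[OF assms, of "\<lambda>x1 y1 x2 y2. - (x1 + x2)"]) (rule that)
  have "\<not> (x < x1 \<and> y2 < y \<and> y < y1)" if p: "(x, y) \<in> P" for x y
  proof
    assume *: "x < x1 \<and> y2 < y \<and> y < y1"
    have "unshaded b00 False False False False False x y x2 y2 a b" if "(a, b) \<in> P" for a b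
    proof -
      have "unshaded b00 False False False False False x1 y1 x2 y2 a b"
        "x1 < x2" "y2 < y1" "a = x1 \<longleftrightarrow> b = y1" "a = x2 \<longleftrightarrow> b = y2"
        using o that avoiding_321_inj[OF assms(1) that] by (simp_all add: occ21_def)
      then show ?thesis using * unfolding unshaded_def by auto
    qed
    then have "occ21 P b00 False False False False False x y x2 y2"
      using o * p unfolding occ21_def by auto
    from m[OF this] * show False by simp
  qed
  moreover have "\<not> (x1 < x \<and> x < x2 \<and> y < y2)" if p: "(x, y) \<in> P" for x y
  proof
    assume *: "x1 < x \<and> x < x2 \<and> y < y2"
    have "unshaded b00 False False False False False x1 y1 x y a b" if "(a, b) \<in> P" for a b
    proof -
      have "unshaded b00 False False False False False x1 y1 x2 y2 a b"
        "x1 < x2" "y2 < y1" "a = x1 \<longleftrightarrow> b = y1" "a = x2 \<longleftrightarrow> b = y2"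
        using o that avoiding_321_inj[OF assms(1) that] by (simp_all add: occ21_def)
      then show ?thesis using * unfolding unshaded_def by auto
    qed
    then have "occ21 P b00 False False False False False x1 y1 x y"
      using o * p unfolding occ21_def by auto
    from m[OF this] * show False by simp
  qed
  ultimately have "occ21 P b00 True True False False False x1 y1 x2 y2"
    using o unfolding occ21_def unshaded_def by blast
  then show ?thesis by (rule contains21I)
qed

text \<open>
  The flag \<open>b00\<close> occurs twice because moving the upper left point up right keeps (0,0) empty only
  if (1,0) is empty as well.
\<close>

lemma contains21_add_10_12:
  assumes "avoiding_321 P" "contains21 P b00 False b00 False False False"
  shows "contains21 P b00 False True True False False"
proof -
  \<comment> \<open>The horizontally narrowest occurrence: a point in (1,0) would move the lower
    right point to the left, one in (1,2) the upper left point to the right.\<close>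
  obtain x1 y1 x2 y2 where o: "occ21 P b00 False b00 False False False x1 y1 x2 y2"
    and m: "\<And>u1 v1 u2 v2. occ21 P b00 False b00 False False False u1 v1 u2 v2 \<Longrightarrow>
      u1 - u2 \<le> x1 - x2"
    by (rule maximal_occ21[OF assms, of "\<lambda>x1 y1 x2 y2. x1 - x2"]) (rule that)
  have "\<not> (x1 < x \<and> x < x2 \<and> y < y2)" if p: "(x, y) \<in> P" for x y
  proof
    assume *: "x1 < x \<and> x < x2 \<and> y < y2"
    have "unshaded b00 False b00 False False False x1 y1 x y a b" if "(a, b) \<in> P" for a b
    proof -
      have "unshaded b00 False b00 False False False x1 y1 x2 y2 a b"
        "x1 < x2" "y2 < y1" "a = x1 \<longleftrightarrow> b = y1" "a = x2 \<longleftrightarrow> b = y2"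
        using o that avoiding_321_inj[OF assms(1) that] by (simp_all add: occ21_def)
      then show ?thesis using * unfolding unshaded_def by auto
    qed
    then have "occ21 P b00 False b00 False False False x1 y1 x y"
      using o * p unfolding occ21_def by auto
    from m[OF this] * show False by simp
  qed
  moreover have "\<not> (x1 < x \<and> x < x2 \<and> y1 < y)" if p: "(x, y) \<in> P" for x y
  proof
    assume *: "x1 < x \<and> x < x2 \<and> y1 < y"
    \<comment> \<open>The new box (0,0) is covered by the old (0,0), the old (1,0) and the column of
      \<open>x1\<close>. The only point in that column is \<open>(x1, y1)\<close>, which lies above
      \<open>y2\<close>.\<close>
    have "unshaded b00 False b00 False False False x y x2 y2 a b" if "(a, b) \<in> P" for a b
    proof -
      have "unshaded b00 False b00 False False False x1 y1 x2 y2 a b"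
        "x1 < x2" "y2 < y1" "a = x1 \<longleftrightarrow> b = y1" "a = x2 \<longleftrightarrow> b = y2"
        using o that avoiding_321_inj[OF assms(1) that] by (simp_all add: occ21_def)
      then show ?thesis using * unfolding unshaded_def by auto
    qed
    then have "occ21 P b00 False b00 False False False x y x2 y2"
      using o * p unfolding occ21_def by auto
    from m[OF this] * show False by simp
  qed
  ultimately have "occ21 P b00 False True True False False x1 y1 x2 y2"
    using o unfolding occ21_def unshaded_def by blast
  then show ?thesis by (rule contains21I)
qed

text \<open>Take an occurrence whose lower right point is leftmost. Replacing that point by one in
  (1,0) shrinks (0,0) and (1,2). Apart from grid lines, (0,1) grows only into (0,0), and (2,2) only
  into (1,2), which are empty.\<close>

lemma contains21_add_10:
  assumes "avoiding_321 P" "contains21 P True True False True False b22"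
  shows "contains21 P True True True True False b22"
proof -
  obtain x1 y1 x2 y2 where o: "occ21 P True True False True False b22 x1 y1 x2 y2"
    and m: "\<And>u1 v1 u2 v2. occ21 P True True False True False b22 u1 v1 u2 v2 \<Longrightarrow>
      - u2 \<le> - x2"
    by (rule maximal_occ21[OF assms, of "\<lambda>x1 y1 x2 y2. - x2"]) (rule that)
  have "\<not> (x1 < x \<and> x < x2 \<and> y < y2)" if p: "(x, y) \<in> P" for x y
  proof
    assume *: "x1 < x \<and> x < x2 \<and> y < y2"
    have "unshaded True True False True False b22 x1 y1 x y a b" if "(a, b) \<in> P" for a b
    proof -
      have "unshaded True True False True False b22 x1 y1 x2 y2 a b"
        "x1 < x2" "y2 < y1" "a = x1 \<longleftrightarrow> b = y1" "a = x2 \<longleftrightarrow> b = y2"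
        using o that avoiding_321_inj[OF assms(1) that] by (simp_all add: occ21_def)
      then show ?thesis using * unfolding unshaded_def by auto
    qed
    then have "occ21 P True True False True False b22 x1 y1 x y"
      using o * p unfolding occ21_def by auto
    from m[OF this] * show False by simp
  qed
  then have "occ21 P True True True True False b22 x1 y1 x2 y2"
    using o unfolding occ21_def unshaded_def by blast
  then show ?thesis by (rule contains21I)
qed

text \<open>Take an occurrence whose lower right point is rightmost. Replacing that point by one in
  (2,1) shrinks (0,1) and (2,2), while (0,0) grows, apart from the row of \<open>y2\<close>, only
  into (0,1), which is empty as well.\<close>

lemma contains21_add_21:
  assumes "avoiding_321 P" "contains21 P True True False False False True"
  shows "contains21 P True True False False True True"
proof -
  obtain x1 y1 x2 y2 where o: "occ21 P True True False False False True x1 y1 x2 y2"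
    and m: "\<And>u1 v1 u2 v2. occ21 P True True False False False True u1 v1 u2 v2 \<Longrightarrow>
      u2 \<le> x2"
    by (rule maximal_occ21[OF assms, of "\<lambda>x1 y1 x2 y2. x2"]) (rule that)
  have "\<not> (x2 < x \<and> y2 < y \<and> y < y1)" if p: "(x, y) \<in> P" for x y
  proof
    assume *: "x2 < x \<and> y2 < y \<and> y < y1"
    have "unshaded True True False False False True x1 y1 x y a b" if "(a, b) \<in> P" for a b
    proof -
      have "unshaded True True False False False True x1 y1 x2 y2 a b"
        "x1 < x2" "y2 < y1" "a = x1 \<longleftrightarrow> b = y1" "a = x2 \<longleftrightarrow> b = y2"
        using o that avoiding_321_inj[OF assms(1) that] by (simp_all add: occ21_def)
      then show ?thesis using * unfolding unshaded_def by auto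
    qed
    then have "occ21 P True True False False False True x1 y1 x y"
      using o * p unfolding occ21_def by auto
    from m[OF this] * show False by simp
  qed
  then have "occ21 P True True False False True True x1 y1 x2 y2"
    using o unfolding occ21_def unshaded_def by blast
  then show ?thesis by (rule contains21I)
qed

text \<open>
  The lower right point is lowest and the upper left one leftmost, so the highest and the rightmost
  point of the set form an occurrence again.
\<close>

lemma contains21_exchange:
  assumes "avoiding_321 P" "contains21 P True True True False False True"
  shows "contains21 P True False False True True True"
proof -
  obtain x1 y1 x2 y2 where o: "occ21 P True True True False False True x1 y1 x2 y2"
    using assms(2) by (auto simp: contains21_def)
  have fin: "finite P" using assms(1) by (simp add: avoiding_321_def)
  have ne: "P \<noteq> {}" using o by (auto simp: occ21_def)
  have no: False if "(a1, c1) \<in> P" "(a2, c2) \<in> P" "(a3, c3) \<in> P" "a1 < a2" "a2 < a3" "c3 < c2" "c2 < c1"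
    for a1 c1 a2 c2 a3 c3
    using assms(1) that unfolding avoiding_321_def by blast
  note inj = avoiding_321_inj[OF assms(1)]
  obtain u v where uv: "(u, v) \<in> P" "\<And>x y. (x, y) \<in> P \<Longrightarrow> y \<le> v"
  proof -
    have "Max (snd ` P) \<in> snd ` P" using fin ne by (intro Max_in) auto
    then obtain x0 y0 where "(x0, y0) \<in> P" "y0 = Max (snd ` P)" by auto
    moreover have "y \<le> Max (snd ` P)" if "(x, y) \<in> P" for x y
      using fin that by (intro Max_ge) force+
    ultimately show ?thesis using that by blast
  qed
  obtain s t where st: "(s, t) \<in> P" "\<And>x y. (x, y) \<in> P \<Longrightarrow> x \<le> s"
  proof -
    have "Max (fst ` P) \<in> fst ` P" using fin ne by (intro Max_in) auto
    then obtain x0 y0 where "(x0, y0) \<in> P" "x0 = Max (fst ` P)" by auto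
    moreover have "x \<le> Max (fst ` P)" if "(x, y) \<in> P" for x y
      using fin that by (intro Max_ge) force+
    ultimately show ?thesis using that by blast
  qed
  \<comment> \<open>Of the nine boxes only (1,2) and (2,1) can contain points: four are shaded, and
    a point in one of the other three would complete a 321.\<close>
  have pos: "x = x1 \<and> y = y1 \<or> x = x2 \<and> y = y2 \<or> x1 < x \<and> x < x2 \<and> y1 < y \<or> x2 < x \<and> y2 < y \<and> y < y1"
    if p: "(x, y) \<in> P" for x y
  proof -
    have "(x1, y1) \<in> P" "(x2, y2) \<in> P" "x1 < x2" "y2 < y1" using o by (auto simp: occ21_def)
    note * = this
    have "x = x1 \<longleftrightarrow> y = y1" "x = x2 \<longleftrightarrow> y = y2" using inj[OF p *(1)] inj[OF p *(2)] by auto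
    moreover have "\<not> (x < x1 \<and> y1 < y)" "\<not> (x1 < x \<and> x < x2 \<and> y2 < y \<and> y < y1)" "\<not> (x2 < x \<and> y < y2)"
      using no[OF p *(1,2)] no[OF *(1) p *(2)] no[OF *(1,2) p] * by auto
    moreover have "\<not> (x < x1 \<and> y < y2)" "\<not> (x < x1 \<and> y2 < y \<and> y < y1)"
      "\<not> (x1 < x \<and> x < x2 \<and> y < y2)" "\<not> (x2 < x \<and> y1 < y)"
      using o p by (auto simp: occ21_def unshaded_def)
    ultimately show ?thesis using *(3,4) by (smt (verit))
  qed
  have "(x1, y1) \<in> P" "(x2, y2) \<in> P" "x1 < x2" "y2 < y1" using o by (auto simp: occ21_def)
  note o' = this
  \<comment> \<open>The highest point is \<open>(x1, y1)\<close> or lies in (1,2); the rightmost one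
    is \<open>(x2, y2)\<close> or lies in (2,1).\<close>
  then have le: "u < x2" "y1 \<le> v" "x2 \<le> s" "t < y1"
    using pos[OF uv(1)] pos[OF st(1)] uv(2)[of x1 y1] st(2)[of x2 y2] by auto
  \<comment> \<open>No point is above \<open>v\<close> or to the right of \<open>s\<close>, which
    empties (1,2), (2,1) and (2,2). Every point has first coordinate at least \<open>x2 > u\<close>
    or second coordinate at least \<open>y1 > t\<close>, which empties (0,0).\<close>
  have "unshaded True False False True True True u v s t x y" if "(x, y) \<in> P" for x y
    using pos[OF that] le uv(2)[OF that] st(2)[OF that] unfolding unshaded_def by auto
  moreover have "u < s" "t < v" using le o' by auto
  ultimately have "occ21 P True False False True True True u v s t"
    using uv(1) st(1) unfolding occ21_def by simp
  then show ?thesis by (rule contains21I)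
qed

section \<open>Coincidences between shadings\<close>

text \<open>The hypotheses leave exactly the subsets of {01,10}, {10,12}, {01,21} and {12,21}. Each
  of these four comes for free by one of the first two extremal choices or by its image under a
  symmetry.\<close>

lemma contains21_no_corner:
  assumes P: "avoiding_321 P" and b: "\<not> (b01 \<and> b12)" "\<not> (b10 \<and> b21)"
  shows "contains21 P False b01 b10 b12 b21 False \<longleftrightarrow> contains21 P False False False False False False"
    (is "?L \<longleftrightarrow> ?R")
proof
  assume ?R
  then have c1: "contains21 P False True True False False False"
    and c2: "contains21 P False False True True False False"
    and c3: "contains21 P False True False False True False"
    and c4: "contains21 P False False False True True False"
    using contains21_add_01_10[OF P, of False] contains21_add_10_12[OF P, of False]
      contains21_add_10_12[OF avoiding_321_swap[OF P], of False]
      contains21_add_01_10[OF avoiding_321_uminus[OF P], of False]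
    by (simp_all add: contains21_swap contains21_uminus)
  consider "\<not> b12" "\<not> b21" | "\<not> b01" "\<not> b21" | "\<not> b12" "\<not> b10" | "\<not> b01" "\<not> b10"
    using b by blast
  then show ?L
  proof cases
    case 1 then show ?thesis by (intro contains21_mono[OF c1]) auto
  next
    case 2 then show ?thesis by (intro contains21_mono[OF c2]) auto
  next
    case 3 then show ?thesis by (intro contains21_mono[OF c3]) auto
  next
    case 4 then show ?thesis by (intro contains21_mono[OF c4]) auto
  qed
next
  assume ?L
  then show ?R by (rule contains21_mono) auto
qed

text \<open>With (0,0) shaded the pair {12,21} is excluded too, so three maximal shadings remain to
  be obtained: {01,10}, {10,12} and {01,21}.\<close>

lemma contains21_lower_corner:
  assumes P: "avoiding_321 P" and b: "\<not> (b01 \<and> b12)" "\<not> (b10 \<and> b21)" "\<not> (b12 \<and> b21)"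
  shows "contains21 P True b01 b10 b12 b21 False \<longleftrightarrow> contains21 P True False False False False False"
    (is "?L \<longleftrightarrow> ?R")
proof
  assume ?R
  then have c1: "contains21 P True True True False False False"
    using contains21_add_01_10[OF P, of True] by simp
  \<comment> \<open>With the corner shaded, \<open>contains21_add_10_12\<close> starts from a
    shading that includes (1,0), and its transpose from one that includes (0,1); \<open>c1\<close>
    supplies these boxes.\<close>
  have "contains21 P True False True False False False" "contains21 P True True False False False False"
    by (rule contains21_mono[OF c1]; simp)+
  then have c2: "contains21 P True False True True False False"
    and c3: "contains21 P True True False False True False"
    using contains21_add_10_12[OF P, of True]
      contains21_add_10_12[OF avoiding_321_swap[OF P], of True]
    by (simp_all add: contains21_swap)
  consider "\<not> b12" "\<not> b21" | "\<not> b01" "\<not> b21" | "\<not> b12" "\<not> b10"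
    using b by blast
  then show ?L
  proof cases
    case 1 then show ?thesis by (intro contains21_mono[OF c1]) auto
  next
    case 2 then show ?thesis by (intro contains21_mono[OF c2]) auto
  next
    case 3 then show ?thesis by (intro contains21_mono[OF c3]) auto
  qed
next
  assume ?L
  then show ?R by (rule contains21_mono) auto
qed

lemma contains21_upper_corner:
  assumes "avoiding_321 P" "\<not> (b01 \<and> b12)" "\<not> (b10 \<and> b21)" "\<not> (b01 \<and> b10)"
  shows "contains21 P False b01 b10 b12 b21 True \<longleftrightarrow> contains21 P False False False False False True"
proof -
  have "\<not> (b21 \<and> b10)" "\<not> (b12 \<and> b01)" "\<not> (b10 \<and> b01)" using assms(2-) by auto
  from contains21_lower_corner[OF avoiding_321_uminus[OF assms(1)] this] show ?thesis
    by (simp add: contains21_uminus)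
qed

text \<open>Orients \<open>contains21_add_10\<close> so that rewriting removes a box. The next three
  lemmas are its images under the symmetries.\<close>

lemma contains21_drop_10:
  assumes "avoiding_321 P"
  shows "contains21 P True True True True False b22 \<longleftrightarrow> contains21 P True True False True False b22"
    (is "?L \<longleftrightarrow> ?R")
proof
  show "?L \<Longrightarrow> ?R" by (erule contains21_mono) auto
qed (rule contains21_add_10[OF assms])

lemma contains21_drop_01:
  assumes "avoiding_321 P"
  shows "contains21 P True True True False True b22 \<longleftrightarrow> contains21 P True False True False True b22"
  using contains21_drop_10[OF avoiding_321_swap[OF assms]] by (simp add: contains21_swap)

lemma contains21_drop_21:
  assumes "avoiding_321 P"
  shows "contains21 P b00 True False True True True \<longleftrightarrow> contains21 P b00 True False True False True"
  using contains21_drop_01[OF avoiding_321_uminus[OF assms]] by (simp add: contains21_uminus)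

lemma contains21_drop_12:
  assumes "avoiding_321 P"
  shows "contains21 P b00 False True True True True \<longleftrightarrow> contains21 P b00 False True False True True"
  using contains21_drop_10[OF avoiding_321_uminus[OF assms]] by (simp add: contains21_uminus)

text \<open>Rotation interchanges {00,01,22} and {00,21,22}, and \<open>contains21_add_21\<close> or
  its rotated form extends either of them to {00,01,21,22}.\<close>

lemma contains21_corners_middle_row:
  assumes P: "avoiding_321 P"
  shows "contains21 P True b01 False False True True \<longleftrightarrow> contains21 P True True False False False True"
proof -
  have 1: "contains21 P True True False False True True \<Longrightarrow> contains21 P True True False False False True"
    by (erule contains21_mono) auto
  have 2: "contains21 P True True False False True True \<Longrightarrow> contains21 P True False False False True True"
    by (erule contains21_mono) auto
  have 3: "contains21 P True False False False True True \<Longrightarrow> contains21 P True True False False True True"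
    using contains21_add_21[OF avoiding_321_uminus[OF P]] by (simp add: contains21_uminus)
  show ?thesis
  proof (cases b01)
    case True
    then have b: "b01 = True" by simp
    show ?thesis unfolding b using 1 contains21_add_21[OF P] by blast
  next
    case False
    then have b: "b01 = False" by simp
    show ?thesis unfolding b using 1 2 3 contains21_add_21[OF P] by blast
  qed
qed

lemma contains21_corners_middle_column:
  assumes "avoiding_321 P"
  shows "contains21 P True False b10 True False True \<longleftrightarrow> contains21 P True False True False False True"
  using contains21_corners_middle_row[OF avoiding_321_swap[OF assms]] by (simp add: contains21_swap)

text \<open>Rotation by 180 degrees interchanges the two shadings, so the converse is the same
  implication for the rotated point set.\<close>

lemma contains21_exchange_iff:
  assumes "avoiding_321 P"
  shows "contains21 P True False False True True True \<longleftrightarrow> contains21 P True True True False False True"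
  using contains21_exchange[OF assms] contains21_exchange[OF avoiding_321_uminus[OF assms]]
  by (auto simp: contains21_uminus)

section \<open>Plots of permutations as point sets\<close>

definition points :: "nat list \<Rightarrow> (int \<times> int) set" where
  "points \<pi> = map_prod int int ` plot \<pi>"

lemma mem_plot_iff: "(x, y) \<in> plot \<pi> \<longleftrightarrow> 1 \<le> x \<and> x \<le> length \<pi> \<and> y = \<pi> ! (x - 1)"
  by (auto simp: plot_def)

lemma plot_Nil: "plot [] = {}"
  by (simp add: plot_def)

text \<open>Evaluates plots of explicit lists entry by entry, as is done for 21, 321 and the
  witnesses.\<close>

lemma plot_Cons: "plot (a # \<pi>) = insert (1, a) ((\<lambda>(x, y). (x + 1, y)) ` plot \<pi>)"
proof -
  have "(x, y) \<in> plot (a # \<pi>) \<longleftrightarrow> (x, y) \<in> insert (1, a) ((\<lambda>(x, y). (x + 1, y)) ` plot \<pi>)" for x y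
  proof (cases x)
    case 0
    then show ?thesis by (auto simp: mem_plot_iff)
  next
    case (Suc k)
    have "(Suc k, y) \<in> (\<lambda>(x, y). (x + 1, y)) ` plot \<pi> \<longleftrightarrow> (k, y) \<in> plot \<pi>" by force
    with Suc show ?thesis by (cases k) (auto simp: mem_plot_iff)
  qed
  then show ?thesis by auto
qed

lemma perms_iff: "\<pi> \<in> perms \<longleftrightarrow> distinct \<pi> \<and> set \<pi> = {1..length \<pi>}"
proof
  assume "\<pi> \<in> perms"
  then obtain n where n: "set \<pi> = {1..n}" "distinct \<pi>"
    unfolding perms_def permutations_of_set_def by blast
  then have "length \<pi> = n" using distinct_card[of \<pi>] by simp
  with n show "distinct \<pi> \<and> set \<pi> = {1..length \<pi>}" by blast
next
  assume "distinct \<pi> \<and> set \<pi> = {1..length \<pi>}"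
  then show "\<pi> \<in> perms" unfolding perms_def permutations_of_set_def by blast
qed

lemma points_mem: "(int x, int y) \<in> points \<pi> \<longleftrightarrow> (x, y) \<in> plot \<pi>"
  by (auto simp: points_def)

lemma points_cases:
  assumes "(x, y) \<in> points \<pi>"
  obtains a b where "x = int a" "y = int b" "(a, b) \<in> plot \<pi>"
  using assms by (auto simp: points_def)

lemma plot_le:
  assumes "\<pi> \<in> perms" "(x, y) \<in> plot \<pi>"
  shows "1 \<le> x" "x \<le> length \<pi>" "1 \<le> y" "y \<le> length \<pi>"
proof -
  have "\<pi> ! (x - 1) \<in> set \<pi>" using assms(2) by (auto simp: mem_plot_iff)
  then show "1 \<le> x" "x \<le> length \<pi>" "1 \<le> y" "y \<le> length \<pi>"
    using assms by (auto simp: mem_plot_iff perms_iff)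
qed

lemma avoids_321_iff:
  assumes "\<pi> \<in> perms"
  shows "avoids \<pi> (classical [3, 2, 1]) \<longleftrightarrow> avoiding_321 (points \<pi>)"
proof -
  have fin: "finite (points \<pi>)"
    unfolding points_def plot_def by (intro finite_imageI finite_image_set) simp
  have inj: "inj_on fst (points \<pi>)" "inj_on snd (points \<pi>)"
    using assms unfolding points_def perms_iff inj_on_def
    by (auto simp: mem_plot_iff nth_eq_iff_index_eq)
  let ?P = "\<lambda>x1 y1 x2 y2 x3 y3. (x1, y1) \<in> plot \<pi> \<and> (x2, y2) \<in> plot \<pi> \<and> (x3, y3) \<in> plot \<pi> \<and>
    x1 < x2 \<and> x2 < x3 \<and> y3 < y2 \<and> y2 < y1"
  have plot3: "plot [3, 2, 1] = {(1, 3), (2, 2), (3, 1)}"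
    by (simp add: plot_Cons plot_Nil del: One_nat_def)
  have len: "length [3, 2, 1 :: nat] = 3" by simp
  have "(\<exists>\<omega>. occurrence (classical [3, 2, 1]) \<pi> \<omega>) \<longleftrightarrow> (\<exists>x1 y1 x2 y2 x3 y3. ?P x1 y1 x2 y2 x3 y3)"
  proof
    assume "\<exists>\<omega>. occurrence (classical [3, 2, 1]) \<pi> \<omega>"
    then obtain \<alpha> \<beta> where "embedding 3 (length \<pi>) \<alpha>" "embedding 3 (length \<pi>) \<beta>"
      and sub: "{(\<alpha> i, \<beta> j) | i j. (i, j) \<in> plot [3, 2, 1]} \<subseteq> plot \<pi>"
      unfolding occurrence_def classical_def prod.case len by blast
    then have "strict_mono_on {1..3} \<alpha>" "strict_mono_on {1..3} \<beta>"
      by (simp_all add: embedding_def)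
    then have lt: "\<alpha> 1 < \<alpha> 2" "\<alpha> 2 < \<alpha> 3" "\<beta> 1 < \<beta> 2" "\<beta> 2 < \<beta> 3"
      by (simp_all add: strict_mono_on_def)
    have "(\<alpha> i, \<beta> j) \<in> plot \<pi>" if "(i, j) \<in> plot [3, 2, 1]" for i j
      using sub that by blast
    from this[of 1 3] this[of 2 2] this[of 3 1]
    have "(\<alpha> 1, \<beta> 3) \<in> plot \<pi>" "(\<alpha> 2, \<beta> 2) \<in> plot \<pi>" "(\<alpha> 3, \<beta> 1) \<in> plot \<pi>"
      by (simp_all add: plot3 del: One_nat_def)
    with lt show "\<exists>x1 y1 x2 y2 x3 y3. ?P x1 y1 x2 y2 x3 y3" by blast
  next
    assume "\<exists>x1 y1 x2 y2 x3 y3. ?P x1 y1 x2 y2 x3 y3"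
    then obtain x1 y1 x2 y2 x3 y3 where *: "?P x1 y1 x2 y2 x3 y3" by blast
    \<comment> \<open>Three values, extended by the boundary values 0 and n+1 of an embedding. The
      row values must increase, hence the reversed order in \<open>g y3 y2 y1\<close>.\<close>
    define g where "g a b c = (\<lambda>i::nat. if i = 0 then 0 else if i = 1 then a else if i = 2 then b
      else if i = 3 then c else length \<pi> + 1)" for a b c :: nat
    have emb: "embedding 3 (length \<pi>) (g x1 x2 x3)" "embedding 3 (length \<pi>) (g y3 y2 y1)"
      using * plot_le[OF assms, of x1 y1] plot_le[OF assms, of x2 y2] plot_le[OF assms, of x3 y3]
      by (auto simp: embedding_def g_def strict_mono_on_def)
    have sub: "{(g x1 x2 x3 i, g y3 y2 y1 j) | i j. (i, j) \<in> plot [3, 2, 1]} \<subseteq> plot \<pi>"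
      using * unfolding plot3 by (auto simp: g_def)
    show "\<exists>\<omega>. occurrence (classical [3, 2, 1]) \<pi> \<omega>"
      unfolding occurrence_def classical_def prod.case len using emb sub by blast
  qed
  also have "\<dots> \<longleftrightarrow>
      (\<exists>x1 y1 x2 y2 x3 y3. (x1, y1) \<in> points \<pi> \<and> (x2, y2) \<in> points \<pi> \<and> (x3, y3) \<in> points \<pi> \<and>
          x1 < x2 \<and> x2 < x3 \<and> y3 < y2 \<and> y2 < y1)" (is "_ \<longleftrightarrow> ?R")
  proof
    assume "\<exists>x1 y1 x2 y2 x3 y3. ?P x1 y1 x2 y2 x3 y3"
    then obtain x1 y1 x2 y2 x3 y3 where *: "?P x1 y1 x2 y2 x3 y3" by blast
    then show ?R
      by (intro exI[of _ "int x1"] exI[of _ "int y1"] exI[of _ "int x2"] exI[of _ "int y2"]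
        exI[of _ "int x3"] exI[of _ "int y3"]) (simp add: points_mem)
  next
    assume ?R
    then obtain x1 y1 x2 y2 x3 y3 where "(x1, y1) \<in> points \<pi>" "(x2, y2) \<in> points \<pi>"
      "(x3, y3) \<in> points \<pi>" and lt: "x1 < x2" "x2 < x3" "y3 < y2" "y2 < y1" by blast
    then obtain a1 b1 a2 b2 a3 b3 where "x1 = int a1" "y1 = int b1" "(a1, b1) \<in> plot \<pi>"
      "x2 = int a2" "y2 = int b2" "(a2, b2) \<in> plot \<pi>" "x3 = int a3" "y3 = int b3" "(a3, b3) \<in> plot \<pi>"
      by (elim points_cases)
    with lt have "?P a1 b1 a2 b2 a3 b3" by simp
    then show "\<exists>x1 y1 x2 y2 x3 y3. ?P x1 y1 x2 y2 x3 y3" by blast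
  qed
  finally show ?thesis
    unfolding avoids_def avoiding_321_def by (simp only: fin inj simp_thms)
qed

section \<open>Occurrences of 21 in a permutation\<close>

definition grid :: "nat \<Rightarrow> nat \<Rightarrow> nat \<Rightarrow> nat \<Rightarrow> nat" where
  "grid n a b i = (if i = 0 then 0 else if i = 1 then a else if i = 2 then b else n + 1)"

lemma plot_21: "plot [2, 1] = {(1, 2), (2, 1)}"
  by (simp add: plot_Cons plot_Nil del: One_nat_def)

text \<open>The two points determine everything: for box indices up to 2, \<open>region\<close>
  reads an embedding only at 0, 1, 2 and 3, where it agrees with \<open>grid\<close>.\<close>

lemma occurrence_21_iff:
  assumes "\<pi> \<in> perms" "R \<subseteq> {0..2} \<times> {0..2}"
  shows "(\<exists>\<omega>. occurrence ([2, 1], R) \<pi> \<omega>) \<longleftrightarrow>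
    (\<exists>x1 y1 x2 y2. (x1, y1) \<in> plot \<pi> \<and> (x2, y2) \<in> plot \<pi> \<and> x1 < x2 \<and> y2 < y1 \<and>
       (\<forall>(i, j) \<in> R. region (grid (length \<pi>) x1 x2) (grid (length \<pi>) y2 y1) i j \<inter> plot \<pi> = {}))"
    (is "?L \<longleftrightarrow> ?R")
proof
  have len: "length [2, 1 :: nat] = 2" by simp
  {
    assume ?L
    then obtain \<alpha> \<beta> where emb: "embedding 2 (length \<pi>) \<alpha>" "embedding 2 (length \<pi>) \<beta>"
      and sub: "{(\<alpha> i, \<beta> j) | i j. (i, j) \<in> plot [2, 1]} \<subseteq> plot \<pi>"
      and reg: "\<forall>(i, j) \<in> R. region \<alpha> \<beta> i j \<inter> plot \<pi> = {}"
      unfolding occurrence_def prod.case len by blast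
    have "\<alpha> 1 < \<alpha> 2" "\<beta> 1 < \<beta> 2"
      using emb by (simp_all add: embedding_def strict_mono_on_def)
    moreover have "(\<alpha> i, \<beta> j) \<in> plot \<pi>" if "(i, j) \<in> plot [2, 1]" for i j
      using sub that by blast
    from this[of 1 2] this[of 2 1]
    have "(\<alpha> 1, \<beta> 2) \<in> plot \<pi>" "(\<alpha> 2, \<beta> 1) \<in> plot \<pi>"
      by (simp_all add: plot_21 del: One_nat_def)
    moreover have "region (grid (length \<pi>) (\<alpha> 1) (\<alpha> 2)) (grid (length \<pi>) (\<beta> 1) (\<beta> 2)) i j = region \<alpha> \<beta> i j"
      if "(i, j) \<in> R" for i j
    proof -
      have "i \<in> {0, 1, 2}" "j \<in> {0, 1, 2}" using that assms(2) by auto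
      then show ?thesis using emb by (auto simp: embedding_def region_def grid_def numeral_eq_Suc)
    qed
    ultimately show ?R using reg by blast
  next
    assume ?R
    then obtain x1 y1 x2 y2 where *: "(x1, y1) \<in> plot \<pi>" "(x2, y2) \<in> plot \<pi>" "x1 < x2" "y2 < y1"
      and reg: "\<forall>(i, j) \<in> R. region (grid (length \<pi>) x1 x2) (grid (length \<pi>) y2 y1) i j \<inter> plot \<pi> = {}"
      by blast
    have emb: "embedding 2 (length \<pi>) (grid (length \<pi>) x1 x2)"
      "embedding 2 (length \<pi>) (grid (length \<pi>) y2 y1)"
      using * plot_le[OF assms(1) *(1)] plot_le[OF assms(1) *(2)]
      by (auto simp: embedding_def grid_def strict_mono_on_def)
    have sub: "{(grid (length \<pi>) x1 x2 i, grid (length \<pi>) y2 y1 j) | i j. (i, j) \<in> plot [2, 1]} \<subseteq> plot \<pi>"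
      using * unfolding plot_21 by (auto simp: grid_def)
    show ?L unfolding occurrence_def prod.case len using emb sub reg by blast
  }
qed

text \<open>Keeps patterns and box indices in numeral form.\<close>

declare One_nat_def [simp del]

lemma avoids_21_iff:
  assumes pi: "\<pi> \<in> perms" and P: "avoiding_321 (points \<pi>)" and R: "R \<subseteq> {0..2} \<times> {0..2}"
  shows "avoids \<pi> ([2, 1], R) \<longleftrightarrow>
    \<not> contains21 (points \<pi>) ((0, 0) \<in> R) ((0, 1) \<in> R) ((1, 0) \<in> R) ((1, 2) \<in> R) ((2, 1) \<in> R) ((2, 2) \<in> R)"
proof -
  let ?u = "unshaded ((0, 0) \<in> R) ((0, 1) \<in> R) ((1, 0) \<in> R) ((1, 2) \<in> R) ((2, 1) \<in> R) ((2, 2) \<in> R)"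
  let ?occ = "occ21 (points \<pi>) ((0, 0) \<in> R) ((0, 1) \<in> R) ((1, 0) \<in> R) ((1, 2) \<in> R) ((2, 1) \<in> R) ((2, 2) \<in> R)"
  let ?g = "grid (length \<pi>)"
  have no: False if "(a1, c1) \<in> plot \<pi>" "(a2, c2) \<in> plot \<pi>" "(a3, c3) \<in> plot \<pi>"
      "a1 < a2" "a2 < a3" "c3 < c2" "c2 < c1" for a1 c1 a2 c2 a3 c3
  proof -
    have "(int a1, int c1) \<in> points \<pi>" "(int a2, int c2) \<in> points \<pi>" "(int a3, int c3) \<in> points \<pi>"
      "int a1 < int a2" "int a2 < int a3" "int c3 < int c2" "int c2 < int c1"
      using that by (simp_all add: points_mem)
    then show False using P unfolding avoiding_321_def by blast
  qed
  have key: "(\<forall>(i, j) \<in> R. region (?g x1 x2) (?g y2 y1) i j \<inter> plot \<pi> = {}) \<longleftrightarrow>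
      ?occ (int x1) (int y1) (int x2) (int y2)"
    if 1: "(x1, y1) \<in> plot \<pi>" and 2: "(x2, y2) \<in> plot \<pi>" and lt: "x1 < x2" "y2 < y1" for x1 y1 x2 y2
  proof
    assume "\<forall>(i, j) \<in> R. region (?g x1 x2) (?g y2 y1) i j \<inter> plot \<pi> = {}"
    then have r: "(x, y) \<notin> region (?g x1 x2) (?g y2 y1) i j" if "(i, j) \<in> R" "(x, y) \<in> plot \<pi>" for i j x y
      using that by blast
    have "?u (int x1) (int y1) (int x2) (int y2) (int x) (int y)" if p: "(x, y) \<in> plot \<pi>" for x y
    proof -
      \<comment> \<open>The bounds 1 and n reduce the intervals of the outer columns and rows, which
        reach the boundary values, to one-sided inequalities.\<close>
      note plot_le[OF pi p]
      then have
        "(0, 0) \<in> R \<Longrightarrow> \<not> (x < x1 \<and> y < y2)"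
        "(0, 1) \<in> R \<Longrightarrow> \<not> (x < x1 \<and> y2 < y \<and> y < y1)"
        "(1, 0) \<in> R \<Longrightarrow> \<not> (x1 < x \<and> x < x2 \<and> y < y2)"
        "(1, 2) \<in> R \<Longrightarrow> \<not> (x1 < x \<and> x < x2 \<and> y1 < y)"
        "(2, 1) \<in> R \<Longrightarrow> \<not> (x2 < x \<and> y2 < y \<and> y < y1)"
        "(2, 2) \<in> R \<Longrightarrow> \<not> (x2 < x \<and> y1 < y)"
        using r[OF _ p, of 0 0] r[OF _ p, of 0 1] r[OF _ p, of 1 0]
          r[OF _ p, of 1 2] r[OF _ p, of 2 1] r[OF _ p, of 2 2]
        by (auto simp: region_def grid_def)
      then show ?thesis unfolding unshaded_def by simp
    qed
    then have "?u (int x1) (int y1) (int x2) (int y2) x y" if "(x, y) \<in> points \<pi>" for x y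
      using that by (auto elim: points_cases)
    then show "?occ (int x1) (int y1) (int x2) (int y2)"
      using 1 2 lt unfolding occ21_def by (simp add: points_mem)
  next
    assume o: "?occ (int x1) (int y1) (int x2) (int y2)"
    have False if ij: "(i, j) \<in> R" and r: "(x, y) \<in> region (?g x1 x2) (?g y2 y1) i j" and p: "(x, y) \<in> plot \<pi>" for i j x y
    proof -
      have "?u (int x1) (int y1) (int x2) (int y2) (int x) (int y)"
        using o p unfolding occ21_def by (simp add: points_mem)
      then have u:
        "(0, 0) \<in> R \<Longrightarrow> \<not> (x < x1 \<and> y < y2)"
        "(0, 1) \<in> R \<Longrightarrow> \<not> (x < x1 \<and> y2 < y \<and> y < y1)"
        "(1, 0) \<in> R \<Longrightarrow> \<not> (x1 < x \<and> x < x2 \<and> y < y2)"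
        "(1, 2) \<in> R \<Longrightarrow> \<not> (x1 < x \<and> x < x2 \<and> y1 < y)"
        "(2, 1) \<in> R \<Longrightarrow> \<not> (x2 < x \<and> y2 < y \<and> y < y1)"
        "(2, 2) \<in> R \<Longrightarrow> \<not> (x2 < x \<and> y1 < y)"
        unfolding unshaded_def by simp_all
      \<comment> \<open>A point in one of the boxes (0,2), (1,1) and (2,0), which carry no flag,
        would complete a 321.\<close>
      have n: "\<not> (x < x1 \<and> y1 < y)" "\<not> (x1 < x \<and> x < x2 \<and> y2 < y \<and> y < y1)" "\<not> (x2 < x \<and> y < y2)"
        using no[OF p 1 2] no[OF 1 p 2] no[OF 1 2 p] lt by auto
      have lo: "i = 0 \<and> x < x1 \<or> i = 1 \<and> x1 < x \<and> x < x2 \<or> i = 2 \<and> x2 < x"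
      proof -
        have "i = 0 \<or> i = 1 \<or> i = 2" using ij R by auto
        then show ?thesis using r lt by (auto simp: region_def grid_def)
      qed
      have hi: "j = 0 \<and> y < y2 \<or> j = 1 \<and> y2 < y \<and> y < y1 \<or> j = 2 \<and> y1 < y"
      proof -
        have "j = 0 \<or> j = 1 \<or> j = 2" using ij R by auto
        then show ?thesis using r lt by (auto simp: region_def grid_def)
      qed
      show False
        using lo hi u n ij by auto
    qed
    then show "\<forall>(i, j) \<in> R. region (?g x1 x2) (?g y2 y1) i j \<inter> plot \<pi> = {}" by fast
  qed
  have "(\<exists>\<omega>. occurrence ([2, 1], R) \<pi> \<omega>) \<longleftrightarrow>
      (\<exists>x1 y1 x2 y2. (x1, y1) \<in> plot \<pi> \<and> (x2, y2) \<in> plot \<pi> \<and> x1 < x2 \<and> y2 < y1 \<and>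
        ?occ (int x1) (int y1) (int x2) (int y2))"
    unfolding occurrence_21_iff[OF pi R]
    by (intro ex_cong1 conj_cong refl) (rule key; assumption)
  also have "\<dots> \<longleftrightarrow> (\<exists>x1 y1 x2 y2. ?occ x1 y1 x2 y2)"
  proof
    assume "\<exists>x1 y1 x2 y2. ?occ x1 y1 x2 y2"
    then obtain x1 y1 x2 y2 where o: "?occ x1 y1 x2 y2" by blast
    then have "(x1, y1) \<in> points \<pi>" "(x2, y2) \<in> points \<pi>" and lt: "x1 < x2" "y2 < y1"
      by (simp_all add: occ21_def)
    then obtain a1 b1 a2 b2 where ab: "x1 = int a1" "y1 = int b1" "(a1, b1) \<in> plot \<pi>"
      "x2 = int a2" "y2 = int b2" "(a2, b2) \<in> plot \<pi>"
      by (elim points_cases)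
    have "a1 < a2" "b2 < b1" "?occ (int a1) (int b1) (int a2) (int b2)" using lt o ab by simp_all
    with ab show "\<exists>x1 y1 x2 y2. (x1, y1) \<in> plot \<pi> \<and> (x2, y2) \<in> plot \<pi> \<and> x1 < x2 \<and> y2 < y1 \<and>
        ?occ (int x1) (int y1) (int x2) (int y2)" by blast
  qed blast
  finally show ?thesis unfolding avoids_def contains21_def by simp
qed

section \<open>Counting the classes\<close>

definition Av321_21 :: "bool \<Rightarrow> bool \<Rightarrow> bool \<Rightarrow> bool \<Rightarrow> bool \<Rightarrow> bool \<Rightarrow> nat list set" where
  "Av321_21 b00 b01 b10 b12 b21 b22 =
     {\<pi> \<in> perms. avoiding_321 (points \<pi>) \<and> \<not> contains21 (points \<pi>) b00 b01 b10 b12 b21 b22}"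

text \<open>Six of the nine memberships survive, so the 512 patterns reduce to 64 flag
  tuples.\<close>

lemma Av_eq_Av321_21:
  assumes "R \<subseteq> {0..2} \<times> {0..2}"
  shows "Av {classical [3, 2, 1], ([2, 1], R)} =
    Av321_21 ((0, 0) \<in> R) ((0, 1) \<in> R) ((1, 0) \<in> R) ((1, 2) \<in> R) ((2, 1) \<in> R) ((2, 2) \<in> R)"
  unfolding Av_def Av321_21_def
  by (rule Collect_cong) (simp add: avoids_321_iff avoids_21_iff assms cong: conj_cong)

lemma Av321_21_cong:
  assumes "\<And>P. avoiding_321 P \<Longrightarrow> contains21 P b00 b01 b10 b12 b21 b22 \<longleftrightarrow> contains21 P c00 c01 c10 c12 c21 c22"
  shows "Av321_21 b00 b01 b10 b12 b21 b22 = Av321_21 c00 c01 c10 c12 c21 c22"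
  unfolding Av321_21_def using assms by blast

text \<open>The normal forms of the rewriting in \<open>Av321_21_in_representatives\<close>, ordered
  by the number of shaded boxes.\<close>

definition representatives :: "(bool \<times> bool \<times> bool \<times> bool \<times> bool \<times> bool) list" where
  "representatives = [
     (False, False, False, False, False, False),
     (True, False, False, False, False, False),
     (False, False, False, False, False, True),
     (True, False, False, False, False, True),
     (False, True, False, True, False, False),
     (False, False, True, False, True, False),
     (True, True, False, True, False, False),
     (True, True, False, False, False, True),
     (True, False, True, False, True, False),
     (True, False, True, False, False, True),
     (True, False, False, True, True, False),
     (False, True, True, True, False, False),
     (False, True, True, False, True, False),
     (False, True, True, False, False, True),
     (False, True, False, True, True, False),
     (False, True, False, True, False, True),
     (False, False, True, True, True, False),
     (False, False, True, False, True, True),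
     (True, True, True, False, False, True),
     (True, True, False, True, True, False),
     (True, True, False, True, False, True),
     (True, False, True, True, True, False),
     (True, False, True, False, True, True),
     (False, True, True, True, True, False),
     (False, True, True, True, False, True),
     (False, True, True, False, True, True),
     (True, True, True, True, True, False),
     (False, True, True, True, True, True),
     (True, True, True, True, True, True)]"

abbreviation "Av_rep \<equiv> \<lambda>(b00, b01, b10, b12, b21, b22). Av321_21 b00 b01 b10 b12 b21 b22"

text \<open>The coincidences, oriented towards the listed shadings, serve as rewrite rules that
  bring each of the 64 flag tuples into the list.\<close>

lemma Av321_21_in_representatives:
  "Av321_21 b00 b01 b10 b12 b21 b22 \<in> Av_rep ` set representatives"
proof -
  \<comment> \<open>The disjunction in the first three equations keeps them from rewriting their right-hand sides.\<close>
  have eq1: "Av321_21 False c01 c10 c12 c21 False = Av321_21 False False False False False False"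
    if "c01 \<or> c10 \<or> c12 \<or> c21" "\<not> (c01 \<and> c12)" "\<not> (c10 \<and> c21)" for c01 c10 c12 c21
    using contains21_no_corner that by (intro Av321_21_cong) blast
  have eq2: "Av321_21 True c01 c10 c12 c21 False = Av321_21 True False False False False False"
    if "c01 \<or> c10 \<or> c12 \<or> c21" "\<not> (c01 \<and> c12)" "\<not> (c10 \<and> c21)" "\<not> (c12 \<and> c21)" for c01 c10 c12 c21
    using contains21_lower_corner that by (intro Av321_21_cong) blast
  have eq3: "Av321_21 False c01 c10 c12 c21 True = Av321_21 False False False False False True"
    if "c01 \<or> c10 \<or> c12 \<or> c21" "\<not> (c01 \<and> c12)" "\<not> (c10 \<and> c21)" "\<not> (c01 \<and> c10)" for c01 c10 c12 c21
    using contains21_upper_corner that by (intro Av321_21_cong) blast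
  note eqs = eq1 eq2 eq3
    Av321_21_cong[OF contains21_drop_10] Av321_21_cong[OF contains21_drop_01]
    Av321_21_cong[OF contains21_drop_21] Av321_21_cong[OF contains21_drop_12]
    Av321_21_cong[OF contains21_corners_middle_row] Av321_21_cong[OF contains21_corners_middle_column]
    Av321_21_cong[OF contains21_exchange_iff]
  show ?thesis
    unfolding representatives_def
    by (cases b00; cases b01; cases b10; cases b12; cases b21; cases b22; simp add: eqs)
qed

section \<open>Separating the representatives by small permutations\<close>

text \<open>This set is closed under inversion and under rotation of the plot by 180
  degrees.\<close>

definition witnesses :: "nat list list" where
  "witnesses = [[1, 3, 2], [2, 1, 3], [2, 3, 1], [3, 1, 2], [2, 4, 1, 3], [3, 1, 4, 2]]"

lemma points_witnesses:
  "points [1, 3, 2] = {(1, 1), (2, 3), (3, 2)}"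
  "points [2, 1, 3] = {(1, 2), (2, 1), (3, 3)}"
  "points [2, 3, 1] = {(1, 2), (2, 3), (3, 1)}"
  "points [3, 1, 2] = {(1, 3), (2, 1), (3, 2)}"
  "points [2, 4, 1, 3] = {(1, 2), (2, 4), (3, 1), (4, 3)}"
  "points [3, 1, 4, 2] = {(1, 3), (2, 1), (3, 4), (4, 2)}"
  by (simp_all add: points_def plot_Cons plot_Nil)

text \<open>Quantifiers bounded by an explicit finite set unfold to finite conjunctions and
  disjunctions, so this form can be evaluated at the witnesses.\<close>

lemma contains21_iff_bex:
  "contains21 P b00 b01 b10 b12 b21 b22 \<longleftrightarrow>
    (\<exists>(x1, y1) \<in> P. \<exists>(x2, y2) \<in> P. x1 < x2 \<and> y2 < y1 \<and>
      (\<forall>(x, y) \<in> P. unshaded b00 b01 b10 b12 b21 b22 x1 y1 x2 y2 x y))"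
  unfolding contains21_def occ21_def Bex_def Ball_def split_paired_Ex split_paired_All prod.case
  by (simp only: ex_simps conj_assoc)

lemma avoiding_321_iff_bex:
  "avoiding_321 P \<longleftrightarrow> finite P \<and> inj_on fst P \<and> inj_on snd P \<and>
     \<not> (\<exists>(x1, y1) \<in> P. \<exists>(x2, y2) \<in> P. x1 < x2 \<and> y2 < y1 \<and> (\<exists>(x3, y3) \<in> P. x2 < x3 \<and> y3 < y2))"
  unfolding avoiding_321_def Bex_def split_paired_Ex prod.case
  by (simp only: ex_simps) meson

lemma witnesses_perms: "set witnesses \<subseteq> perms"
  by (simp add: witnesses_def perms_iff atLeastAtMostSuc_conv)
    (simp add: numeral_eq_Suc One_nat_def insert_commute)

lemma witnesses_avoid: "\<pi> \<in> set witnesses \<Longrightarrow> avoiding_321 (points \<pi>)"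
  unfolding witnesses_def
  by (auto simp: points_witnesses avoiding_321_iff_bex)

text \<open>Some inversion must have the boxes of all other points unshaded. In 2413, the inversion
  21 has 4 in (1,2) and 3 in (2,2), the inversion 41 has 2 in (0,1) and 3 in (2,1), and 43 has 2 in
  (0,0) and 1 in (1,0).\<close>

lemma contains21_witnesses:
  "contains21 (points [1, 3, 2]) b00 b01 b10 b12 b21 b22 \<longleftrightarrow> \<not> b00"
  "contains21 (points [2, 1, 3]) b00 b01 b10 b12 b21 b22 \<longleftrightarrow> \<not> b22"
  "contains21 (points [2, 3, 1]) b00 b01 b10 b12 b21 b22 \<longleftrightarrow> \<not> (b01 \<and> b12)"
  "contains21 (points [3, 1, 2]) b00 b01 b10 b12 b21 b22 \<longleftrightarrow> \<not> (b10 \<and> b21)"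
  "contains21 (points [2, 4, 1, 3]) b00 b01 b10 b12 b21 b22 \<longleftrightarrow>
    \<not> b12 \<and> \<not> b22 \<or> \<not> b01 \<and> \<not> b21 \<or> \<not> b00 \<and> \<not> b10"
  "contains21 (points [3, 1, 4, 2]) b00 b01 b10 b12 b21 b22 \<longleftrightarrow>
    \<not> b21 \<and> \<not> b22 \<or> \<not> b10 \<and> \<not> b12 \<or> \<not> b00 \<and> \<not> b01"
  by (simp_all add: points_witnesses contains21_iff_bex unshaded_def; blast)+

text \<open>The vector telling which witnesses lie in a set is a function of that set, so it
  suffices that the 29 vectors differ.\<close>

lemma distinct_Av_representatives: "distinct (map Av_rep representatives)"
proof -
  define sig where "sig A = map (\<lambda>\<pi>. \<pi> \<in> A) witnesses" for A
  have mem: "\<pi> \<in> Av321_21 b00 b01 b10 b12 b21 b22 \<longleftrightarrow> \<not> contains21 (points \<pi>) b00 b01 b10 b12 b21 b22"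
    if "\<pi> \<in> set witnesses" for \<pi> b00 b01 b10 b12 b21 b22
    using that witnesses_perms witnesses_avoid unfolding Av321_21_def by blast
  have sig: "sig (Av321_21 b00 b01 b10 b12 b21 b22) =
      [b00, b22, b01 \<and> b12, b10 \<and> b21,
       (b12 \<or> b22) \<and> (b01 \<or> b21) \<and> (b00 \<or> b10), (b21 \<or> b22) \<and> (b10 \<or> b12) \<and> (b00 \<or> b01)]"
    for b00 b01 b10 b12 b21 b22
  proof -
    have "sig (Av321_21 b00 b01 b10 b12 b21 b22) =
        map (\<lambda>\<pi>. \<not> contains21 (points \<pi>) b00 b01 b10 b12 b21 b22) witnesses"
      unfolding sig_def using mem by (intro map_cong) auto
    then show ?thesis by (simp add: witnesses_def contains21_witnesses)
  qed
  have "distinct (map sig (map Av_rep representatives))"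
    by (simp add: representatives_def sig)
  then show ?thesis by (simp only: distinct_map)
qed

section \<open>The number of classes\<close>

text \<open>The classes are the nonempty fibres of \<open>f\<close> on \<open>M\<close>, one for
  each value.\<close>

lemma card_quotient_kernel: "card (M // {(p, q) \<in> M \<times> M. f p = f q}) = card (f ` M)"
proof -
  let ?r = "{(p, q) \<in> M \<times> M. f p = f q}"
  have "M // ?r = (\<lambda>p. ?r `` {p}) ` M"
    unfolding quotient_def by blast
  also have "\<dots> = (\<lambda>p. {q \<in> M. f q = f p}) ` M"
    by (intro image_cong refl) auto
  finally have "M // ?r = (\<lambda>v. {q \<in> M. f q = v}) ` f ` M"
    by (simp only: image_image)
  moreover have "inj_on (\<lambda>v. {q \<in> M. f q = v}) (f ` M)"
    by (rule inj_onI) blast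
  ultimately show ?thesis by (simp add: card_image)
qed

theorem mainTheorem4:
  shows "card (mesh_patterns_on [2, 1]) = 512 \<and>
    equiv (mesh_patterns_on [2, 1]) (coincidence_under [3, 2, 1] (mesh_patterns_on [2, 1])) \<and>
    card (mesh_patterns_on [2, 1] // coincidence_under [3, 2, 1] (mesh_patterns_on [2, 1])) = 29"
proof (intro conjI)
  let ?M = "mesh_patterns_on [2, 1]"
  let ?f = "\<lambda>p. Av {classical [3, 2, 1], p}"
  have len: "length [2, 1 :: nat] = 2" by simp
  have M: "?M = Pair [2, 1] ` Pow ({0..2} \<times> {0..2})"
    unfolding mesh_patterns_on_def len by auto
  show "card ?M = 512"
    unfolding M by (subst card_image) (auto simp: inj_on_def card_Pow card_cartesian_product)
  show "equiv ?M (coincidence_under [3, 2, 1] ?M)"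
    unfolding coincidence_under_def by (intro equivI refl_onI symI transI) auto
  have "?f ` ?M = set (map Av_rep representatives)"
  proof
    show "?f ` ?M \<subseteq> set (map Av_rep representatives)"
      unfolding M set_map using Av321_21_in_representatives by (auto simp: Av_eq_Av321_21)
    have "Av321_21 b00 b01 b10 b12 b21 b22 \<in> ?f ` ?M" for b00 b01 b10 b12 b21 b22
    proof -
      \<comment> \<open>Shading exactly the flagged boxes shows that every flag tuple comes from a
        pattern.\<close>
      let ?R = "{p. b00 \<and> p = (0, 0) \<or> b01 \<and> p = (0, 1) \<or> b10 \<and> p = (1, 0) \<or>
        b12 \<and> p = (1, 2) \<or> b21 \<and> p = (2, 1) \<or> b22 \<and> p = (2, 2)} :: (nat \<times> nat) set"
      have R: "?R \<subseteq> {0..2} \<times> {0..2}" by auto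
      have "Av321_21 b00 b01 b10 b12 b21 b22 = ?f ([2, 1], ?R)"
        unfolding Av_eq_Av321_21[OF R] by simp
      moreover have "([2, 1], ?R) \<in> ?M" using R unfolding M by blast
      ultimately show ?thesis by blast
    qed
    then show "set (map Av_rep representatives) \<subseteq> ?f ` ?M" by auto
  qed
  then have "card (?f ` ?M) = length representatives"
    using distinct_card[OF distinct_Av_representatives] by simp
  then show "card (?M // coincidence_under [3, 2, 1] ?M) = 29"
    unfolding coincidence_under_def card_quotient_kernel by (simp add: representatives_def)
qed

end
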